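(* Let $\Omega=\Omega_1\times\cdots\times\Omega_d\subseteq\mathbb{R}^d$ with $\mu(\Omega)<\infty$, and let $\vec p=(p_1,\dots,p_d)$ with $0<p_i\le\infty$ for all $i$ and $0<\min\{p_1,\dots,p_d\}<\infty$. If $r>\min\{p_1,\dots,p_d\}$ is a real number, then 1. $L_{\vec p}(\Omega)\not\hookrightarrow L_r(\Omega)$, and 2. $L_{\vec p,q}(\Omega)\not\hookrightarrow L_{r,s}(\Omega)$ for all $0<q,s\le\infty$.
   Context: Setting: $\Omega_1,\dots,\Omega_d\subseteq\mathbb{R}$ are Lebesgue measurable sets of positive measure, $\Omega=\prod_i\Omega_i$, and $\mu$ is Lebesgue measure on $\Omega$. $X_1\hookrightarrow X_2$ means $X_1\subseteq X_2$ with continuous inclusion, i.e. $\|f\|_{X_2}\le c\|f\|_{X_1}$ for some $c>0$ and all $f\in X_1$; $\not\hookrightarrow$ is its negation. Mixed Lebesgue space: $L_{\vec p}(\Omega)$ consists of the measurable $f:\Omega\to\mathbb{R}$ with finite quasi-norm $$\|f\|_{\vec p}=\left(\int_{\Omega_d}\cdots\left(\int_{\Omega_1}|f(x_1,\dots,x_d)|^{p_1}\,dx_1\right)^{p_2/p_1}\cdots\,dx_d\right)^{1/p_d},$$ i.e. one takes the $L_{p_1}$ quasi-norm in $x_1$, then the $L_{p_2}$ quasi-norm in $x_2$, etc., with the essential supremum in $x_j$ if $p_j=\infty$. Mixed Lorentz space: $L_{\vec p,q}(\Omega)$ consists of the measurable $f$ with finite quasi-norm $$\|f\|_{L_{\vec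 p,q}}=\left(\int_0^\infty u^q\,\|\chi_{\{|f|>u\}}\|_{\vec p}^q\,\frac{du}{u}\right)^{1/q}\ (0<q<\infty),\qquad \|f\|_{L_{\vec p,\infty}}=\sup_{u>0}u\,\|\chi_{\{|f|>u\}}\|_{\vec p},$$ where $\chi_A$ denotes the characteristic function of $A$. Classical Lorentz space $L_{r,s}(\Omega)$: quasi-norm $\|f\|_{L_{r,s}}=\left(\int_0^\infty(t^{1/r}f^*(t))^s\frac{dt}{t}\right)^{1/s}$ for $0<s<\infty$ and $\sup_{t>0}t^{1/r}f^*(t)$ for $s=\infty$, where $f^*(t)=\inf\{\sigma>0:\mu(\{|f|>\sigma\})\le t\}$. $L_r(\Omega)$ is the usual Lebesgue space. *)

theory Defs
  imports "HOL-Analysis.Analysis" "HOL-Probability.Essential_Supremum"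
begin

definition enn_powr :: "ennreal \<Rightarrow> real \<Rightarrow> ennreal" where
  "enn_powr x a = (if x = \<infinity> then \<infinity> else ennreal (enn2real x powr a))"
  \<comment> \<open>only used for \<open>a > 0\<close>\<close>

definition Lp_qnorm :: "ennreal \<Rightarrow> 'a measure \<Rightarrow> ('a \<Rightarrow> ennreal) \<Rightarrow> ennreal" where
  "Lp_qnorm p M F =
     (if p = \<infinity> then esssup M F
      else enn_powr (\<integral>\<^sup>+ x. enn_powr (F x) (enn2real p) \<partial>M) (1 / enn2real p))"

text \<open>
  Coordinates of \<open>\<real>\<^sup>d\<close> are indexed by a finite linearly ordered type \<open>'n\<close>; its increasing
  enumeration plays the role of \<open>1, \<dots>, d\<close>.
\<close>

definition prod_set :: "('n::finite \<Rightarrow> real set) \<Rightarrow> (real^'n) set" where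
  "prod_set \<Omega> = {x. \<forall>i. x $ i \<in> \<Omega> i}"

definition vec_upd :: "real^'n \<Rightarrow> 'n \<Rightarrow> real \<Rightarrow> real^'n" where
  "vec_upd x i t = (\<chi> j. if j = i then t else x $ j)"

text \<open>
  \<open>iter_qnorm \<Omega> p is F x\<close> takes the quasi-norms in the coordinates \<open>is\<close>, the head of the list
  being the innermost one; the remaining coordinates are frozen at those of \<open>x\<close>.
  Sections of a Lebesgue measurable \<open>F\<close> are measurable only for almost all values of the other
  coordinates; the exceptional null set does not influence the outer quasi-norms.
\<close>

primrec iter_qnorm ::
  "('n::finite \<Rightarrow> real set) \<Rightarrow> ('n \<Rightarrow> ennreal) \<Rightarrow> 'n list \<Rightarrow> (real^'n \<Rightarrow> ennreal) \<Rightarrow> real^'n \<Rightarrow> ennreal"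
where
  "iter_qnorm \<Omega> p [] F = F"
| "iter_qnorm \<Omega> p (i # is) F =
     iter_qnorm \<Omega> p is (\<lambda>x. Lp_qnorm (p i) (lebesgue_on (\<Omega> i)) (\<lambda>t. F (vec_upd x i t)))"

text \<open>All coordinates get overwritten, so the base point \<open>0\<close> below is irrelevant.\<close>

definition mixed_qnorm ::
  "('n \<Rightarrow> real set) \<Rightarrow> ('n \<Rightarrow> ennreal) \<Rightarrow> (real^'n::{finite,linorder} \<Rightarrow> real) \<Rightarrow> ennreal" where
  "mixed_qnorm \<Omega> p f = iter_qnorm \<Omega> p (sorted_list_of_set UNIV) (\<lambda>x. ennreal \<bar>f x\<bar>) 0"

text \<open>The \<open>L\<^sub>s\<close> quasi-norm on \<open>(0, \<infinity>)\<close> with respect to \<open>dt/t\<close>, with a genuine supremum for \<open>s = \<infinity>\<close>.\<close>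

definition dilation_qnorm :: "ennreal \<Rightarrow> (real \<Rightarrow> ennreal) \<Rightarrow> ennreal" where
  "dilation_qnorm s h =
     (if s = \<infinity> then (SUP t\<in>{0<..}. h t)
      else enn_powr (\<integral>\<^sup>+ t\<in>{0<..}. (enn_powr (h t) (enn2real s) / ennreal t) \<partial>lborel) (1 / enn2real s))"

definition mixed_lorentz_qnorm ::
  "('n \<Rightarrow> real set) \<Rightarrow> ('n \<Rightarrow> ennreal) \<Rightarrow> ennreal \<Rightarrow> (real^'n::{finite,linorder} \<Rightarrow> real) \<Rightarrow> ennreal" where
  "mixed_lorentz_qnorm \<Omega> p q f =
     dilation_qnorm q
       (\<lambda>u. ennreal u * mixed_qnorm \<Omega> p (indicator {x \<in> prod_set \<Omega>. \<bar>f x\<bar> > u}))"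

definition rearrangement :: "'a measure \<Rightarrow> ('a \<Rightarrow> real) \<Rightarrow> real \<Rightarrow> ennreal" where
  "rearrangement M f t =
     Inf (ennreal ` {\<sigma>. \<sigma> > 0 \<and> emeasure M {x \<in> space M. \<bar>f x\<bar> > \<sigma>} \<le> ennreal t})"

definition lorentz_qnorm :: "'a measure \<Rightarrow> real \<Rightarrow> ennreal \<Rightarrow> ('a \<Rightarrow> real) \<Rightarrow> ennreal" where
  "lorentz_qnorm M r s f =
     dilation_qnorm s (\<lambda>t. ennreal (t powr (1 / r)) * rearrangement M f t)"

text \<open>
  A function space is a carrier together with its quasi-norm. Carriers consist of functions
  rather than almost-everywhere classes, and only the values on \<open>\<Omega>\<close> matter.
\<close>

type_synonym 'f qspace = "'f set \<times> ('f \<Rightarrow> ennreal)"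

definition fun_space :: "'a measure \<Rightarrow> (('a \<Rightarrow> real) \<Rightarrow> ennreal) \<Rightarrow> ('a \<Rightarrow> real) qspace" where
  "fun_space M N = ({f \<in> borel_measurable M. N f < \<infinity>}, N)"

definition Lebesgue_space :: "('n::finite \<Rightarrow> real set) \<Rightarrow> ennreal \<Rightarrow> (real^'n \<Rightarrow> real) qspace" where
  "Lebesgue_space \<Omega> r =
     fun_space (lebesgue_on (prod_set \<Omega>))
       (\<lambda>f. Lp_qnorm r (lebesgue_on (prod_set \<Omega>)) (\<lambda>x. ennreal \<bar>f x\<bar>))"

definition Lorentz_space :: "('n::finite \<Rightarrow> real set) \<Rightarrow> real \<Rightarrow> ennreal \<Rightarrow> (real^'n \<Rightarrow> real) qspace" where
  "Lorentz_space \<Omega> r s =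
     fun_space (lebesgue_on (prod_set \<Omega>)) (lorentz_qnorm (lebesgue_on (prod_set \<Omega>)) r s)"

definition mixed_Lebesgue_space ::
  "('n \<Rightarrow> real set) \<Rightarrow> ('n \<Rightarrow> ennreal) \<Rightarrow> (real^'n::{finite,linorder} \<Rightarrow> real) qspace" where
  "mixed_Lebesgue_space \<Omega> p = fun_space (lebesgue_on (prod_set \<Omega>)) (mixed_qnorm \<Omega> p)"

definition mixed_Lorentz_space ::
  "('n \<Rightarrow> real set) \<Rightarrow> ('n \<Rightarrow> ennreal) \<Rightarrow> ennreal \<Rightarrow> (real^'n::{finite,linorder} \<Rightarrow> real) qspace" where
  "mixed_Lorentz_space \<Omega> p q = fun_space (lebesgue_on (prod_set \<Omega>)) (mixed_lorentz_qnorm \<Omega> p q)"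

definition cont_embedded :: "'f qspace \<Rightarrow> 'f qspace \<Rightarrow> bool"  (infix \<open>\<hookrightarrow>\<close> 50) where
  "X\<^sub>1 \<hookrightarrow> X\<^sub>2 \<longleftrightarrow>
     fst X\<^sub>1 \<subseteq> fst X\<^sub>2 \<and> (\<exists>c::real. c > 0 \<and> (\<forall>f \<in> fst X\<^sub>1. snd X\<^sub>2 f \<le> ennreal c * snd X\<^sub>1 f))"

end

theory Submission
  imports Defs
begin

text \<open>
  Let \<open>p\<^sub>k\<close> be the smallest exponent and shrink \<open>\<Omega>\<close> in the \<open>k\<close>-th direction only, to a set of
  measure \<open>m\<close>. The characteristic function of the resulting rectangle has both mixed quasi-norms
  proportional to \<open>m\<close> to the power \<open>1/p\<^sub>k\<close>, whereas its \<open>L\<^sub>r\<close> and \<open>L\<^sub>r\<^sub>,\<^sub>s\<close> quasi-norms are at least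
  a constant times \<open>m\<close> to the power \<open>1/r\<close>. Since \<open>1/r < 1/p\<^sub>k\<close>, no inequality between them
  survives \<open>m \<rightarrow> 0\<close>.
\<close>

section \<open>Powers of extended nonnegative reals\<close>

lemma enn_powr_ennreal: "x \<ge> 0 \<Longrightarrow> enn_powr (ennreal x) a = ennreal (x powr a)"
  by (simp add: enn_powr_def)

lemma enn_powr_0 [simp]: "enn_powr 0 a = 0"
  by (simp add: enn_powr_def)

lemma enn_powr_1 [simp]: "enn_powr 1 a = 1"
  by (simp add: enn_powr_def)

lemma enn_powr_top [simp]: "enn_powr top a = top"
  by (simp add: enn_powr_def)

lemma enn_powr_eq_0_iff [simp]: "enn_powr x a = 0 \<longleftrightarrow> x = 0"
  by (cases x) (auto simp: enn_powr_def ennreal_eq_0_iff)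

lemma enn_powr_eq_top_iff [simp]: "enn_powr x a = top \<longleftrightarrow> x = top"
  by (simp add: enn_powr_def)

text \<open>Every exponent fixes 0 and \<open>top\<close>, so the convention 0 * \<open>top\<close>
  = 0 is respected and only the finite case calls for the real power law.\<close>

lemma enn_powr_mult: "enn_powr (x * y) a = enn_powr x a * enn_powr y a"
proof (cases "x = top \<or> y = top")
  case True
  then show ?thesis
    by (cases "x = 0"; cases "y = 0") (auto simp: ennreal_mult_top ennreal_top_mult)
next
  case False
  then obtain u v where "x = ennreal u" "y = ennreal v" "u \<ge> 0" "v \<ge> 0"
    by (metis ennreal_cases infinity_ennreal_def)
  then show ?thesis
    by (simp add: enn_powr_ennreal powr_mult flip: ennreal_mult)
qed

lemma enn_powr_inverse: "a \<noteq> 0 \<Longrightarrow> enn_powr (enn_powr x a) (1 / a) = x"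
  by (cases x) (auto simp: enn_powr_ennreal powr_powr)

lemma enn_powr_mono: "a > 0 \<Longrightarrow> x \<le> y \<Longrightarrow> enn_powr x a \<le> enn_powr y a"
  by (cases x; cases y) (auto simp: enn_powr_ennreal powr_mono2 top_unique)

lemma enn_powr_indicator: "enn_powr (indicator A x) a = indicator A x"
  by (simp split: split_indicator)

lemma enn2real_pos: "0 < p \<Longrightarrow> p \<noteq> \<infinity> \<Longrightarrow> 0 < enn2real p"
  by (simp add: enn2real_positive_iff less_top)

section \<open>Quasi-norms of multiples of indicators\<close>

lemma Lp_qnorm_indicator:
  assumes "p \<noteq> \<infinity>" "B \<in> sets M"
  shows "Lp_qnorm p M (indicator B) = enn_powr (emeasure M B) (1 / enn2real p)"
  using assms by (simp add: Lp_qnorm_def enn_powr_indicator)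

text \<open>On the space the function is the constant \<open>c\<close>. Positive total measure
  matters: over a null space the essential supremum would be 0.\<close>

lemma Lp_qnorm_indicator_infinity:
  assumes "space M \<subseteq> B" "emeasure M (space M) \<noteq> 0"
  shows "Lp_qnorm \<infinity> M (\<lambda>t. c * indicator B t) = c"
proof -
  have *: "c * indicator B t = c" if "t \<in> space M" for t
    using that assms(1) by (auto simp: indicator_def)
  then have "(\<lambda>t. c * indicator B t) \<in> borel_measurable M"
    by (subst measurable_cong[where g = "\<lambda>_. c"]) auto
  then have "esssup M (\<lambda>t. c * indicator B t) = esssup M (\<lambda>_. c)"
    by (intro esssup_AE_cong) (auto simp: *)
  then show ?thesis
    using assms(2) by (simp add: Lp_qnorm_def esssup_const)
qed

text \<open>Homogeneity in the form the iteration needs, with \<open>c\<close> carrying everything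
  frozen during one integration. For an infinite exponent, two evaluations on the full space are
  compared.\<close>

lemma Lp_qnorm_mult_indicator:
  assumes "0 < p" "B \<in> sets M" "emeasure M (space M) \<noteq> 0" "p = \<infinity> \<Longrightarrow> B = space M"
  shows "Lp_qnorm p M (\<lambda>t. c * indicator B t) = c * Lp_qnorm p M (indicator B)"
proof (cases "p = \<infinity>")
  case True
  then show ?thesis
    using assms Lp_qnorm_indicator_infinity[of M B c] Lp_qnorm_indicator_infinity[of M B 1]
    by simp
next
  case False
  let ?a = "enn2real p"
  have "?a > 0" using assms(1) False by (rule enn2real_pos)
  have "Lp_qnorm p M (\<lambda>t. c * indicator B t) = enn_powr (enn_powr c ?a * emeasure M B) (1 / ?a)"
    using False assms(2)
    by (simp add: Lp_qnorm_def enn_powr_mult enn_powr_indicator nn_integral_cmult_indicator)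
  also have "\<dots> = c * enn_powr (emeasure M B) (1 / ?a)"
    using \<open>?a > 0\<close> by (simp add: enn_powr_mult enn_powr_inverse)
  finally show ?thesis using Lp_qnorm_indicator[OF False assms(2)] by simp
qed

text \<open>The innermost quasi-norm sees the factors in the other coordinates as a constant and
  turns its own factor into a number. That number is absorbed into \<open>c\<close>, hence the
  generalization over \<open>c\<close> in the induction.\<close>

lemma iter_qnorm_prod_indicator:
  fixes \<Omega> B :: "'n::finite \<Rightarrow> real set"
  assumes "distinct is"
    and "\<And>i. i \<in> set is \<Longrightarrow> 0 < p i \<and> B i \<in> sets (lebesgue_on (\<Omega> i)) \<and>
           emeasure (lebesgue_on (\<Omega> i)) (\<Omega> i) \<noteq> 0 \<and> (p i = \<infinity> \<longrightarrow> B i = \<Omega> i)"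
  shows "iter_qnorm \<Omega> p is (\<lambda>x. c * (\<Prod>j\<in>set is. indicator (B j) (x $ j))) x =
         c * (\<Prod>j\<in>set is. Lp_qnorm (p j) (lebesgue_on (\<Omega> j)) (indicator (B j)))"
  using assms
proof (induction "is" arbitrary: c)
  case Nil
  then show ?case by simp
next
  case (Cons i "is")
  let ?L = "Lp_qnorm (p i) (lebesgue_on (\<Omega> i)) (indicator (B i))"
  have i: "i \<notin> set is" using Cons.prems(1) by simp
  \<comment> \<open>Since \<open>i\<close> does not recur in \<open>is\<close>, overwriting
    coordinate \<open>i\<close> leaves the later factors alone.\<close>
  have "(\<Prod>j\<in>set (i # is). indicator (B j) (vec_upd x i t $ j)) =
        (\<Prod>j\<in>set is. indicator (B j) (x $ j)) * (indicator (B i) t :: ennreal)" for x t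
  proof -
    have "(\<Prod>j\<in>set is. indicator (B j) (vec_upd x i t $ j)) =
          (\<Prod>j\<in>set is. indicator (B j) (x $ j) :: ennreal)"
      using i by (intro prod.cong) (auto simp: vec_upd_def)
    then show ?thesis
      using i by (simp add: vec_upd_def mult.commute)
  qed
  then have "Lp_qnorm (p i) (lebesgue_on (\<Omega> i))
      (\<lambda>t. c * (\<Prod>j\<in>set (i # is). indicator (B j) (vec_upd x i t $ j))) =
      c * ?L * (\<Prod>j\<in>set is. indicator (B j) (x $ j))" for x
    using Cons.prems(2)[of i]
      Lp_qnorm_mult_indicator[of "p i" "B i" "lebesgue_on (\<Omega> i)"
        "c * (\<Prod>j\<in>set is. indicator (B j) (x $ j))"]
    by (simp add: ac_simps)
  then show ?case
    using Cons.IH[of "c * ?L"] Cons.prems i by (simp add: mult.assoc)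
qed

lemma indicator_prod_set:
  "(indicator (prod_set B) x :: 'b::comm_semiring_1) = (\<Prod>j\<in>UNIV. indicator (B j) (x $ j))"
proof (cases "x \<in> prod_set B")
  case False
  then obtain j where "x $ j \<notin> B j" by (auto simp: prod_set_def)
  then have "(\<Prod>j\<in>UNIV. indicator (B j) (x $ j)) = (0 :: 'b)"
    by (intro prod_zero bexI[of _ j]) auto
  with False show ?thesis by simp
qed (simp add: prod_set_def)

section \<open>Lebesgue measure of products\<close>

lemma Basis_real_vec: "(Basis :: (real^'n) set) = range (\<lambda>i. axis i 1)"
  by (auto simp: Basis_vec_def)

lemma prod_set_borel:
  assumes "\<And>i. B i \<in> sets borel"
  shows "prod_set B \<in> sets (borel :: (real^'n) measure)"
proof -
  have "(\<lambda>x::real^'n. x $ i) -` B i \<inter> space borel \<in> sets borel" for i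
    by (rule measurable_sets[OF _ assms]) (intro borel_measurable_continuous_onI continuous_intros)
  then have "(\<Inter>i. (\<lambda>x::real^'n. x $ i) -` B i) \<in> sets borel"
    by (intro sets.countable_INT') auto
  moreover have "prod_set B = (\<Inter>i. (\<lambda>x::real^'n. x $ i) -` B i)"
    by (auto simp: prod_set_def)
  ultimately show ?thesis by simp
qed

text \<open>Tonelli for a product of one-dimensional indicators, once coordinates are renamed as
  basis vectors.\<close>

lemma emeasure_lborel_prod_set:
  fixes B :: "'n::finite \<Rightarrow> real set"
  assumes "\<And>i. B i \<in> sets borel"
  shows "emeasure lborel (prod_set B) = (\<Prod>i\<in>UNIV. emeasure lborel (B i))"
proof -
  have inj: "inj (\<lambda>i::'n. axis i (1::real))" by (simp add: inj_on_def axis_eq_axis)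
  \<comment> \<open>\<open>ix\<close> recovers a coordinate from its basis vector, so that the
    factors can be indexed by \<open>Basis\<close>.\<close>
  define ix where "ix = inv (\<lambda>i::'n. axis i (1::real))"
  have [simp]: "ix (axis i 1) = i" for i
    unfolding ix_def using inj by (rule inv_f_f)
  have "emeasure lborel (prod_set B) = (\<integral>\<^sup>+x. indicator (prod_set B) x \<partial>lborel)"
    using prod_set_borel[of B, OF assms] by simp
  also have "\<dots> = (\<integral>\<^sup>+x. (\<Prod>b\<in>Basis. indicator (B (ix b)) (x \<bullet> b)) \<partial>lborel)"
    by (intro nn_integral_cong)
       (simp add: indicator_prod_set Basis_real_vec prod.reindex[OF inj] inner_axis)
  also have "\<dots> = (\<Prod>b\<in>(Basis::(real^'n) set). (\<integral>\<^sup>+x. indicator (B (ix b)) x \<partial>lborel))"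
    using assms by (intro nn_integral_lborel_prod) auto
  also have "\<dots> = (\<Prod>i\<in>UNIV. emeasure lborel (B i))"
    using assms by (simp add: Basis_real_vec prod.reindex[OF inj])
  finally show ?thesis .
qed

text \<open>Each side lies between a Borel set \<open>S i\<close> and its enlargement by a Borel
  null set \<open>N i\<close>. The product of the Borel cores misses only a null set, so the Borel
  case carries over to the completion.\<close>

lemma emeasure_lebesgue_prod_set:
  fixes B :: "'n::finite \<Rightarrow> real set"
  assumes "\<And>i. B i \<in> sets lebesgue"
  shows prod_set_lebesgue: "prod_set B \<in> sets lebesgue"
    and "emeasure lebesgue (prod_set B) = (\<Prod>i\<in>UNIV. emeasure lebesgue (B i))"
proof -
  have "\<exists>S N. S \<subseteq> B i \<and> B i \<subseteq> S \<union> N \<and> S \<in> sets borel \<and> N \<in> null_sets lborel" for i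
    using sets_completionE[OF assms[of i]] by (metis Un_upper1 Un_mono order_refl sets_lborel)
  then obtain S N where SN: "\<And>i. S i \<subseteq> B i" "\<And>i. B i \<subseteq> S i \<union> N i"
      "\<And>i. S i \<in> sets borel" "\<And>i. N i \<in> null_sets lborel"
    by metis
  \<comment> \<open>\<open>Z i\<close> is a slab confined in direction \<open>i\<close> only. It is
    null although its other sides have infinite length, because 0 * \<open>top\<close> = 0.\<close>
  define Z where "Z i = prod_set (\<lambda>j. if j = i then N i else UNIV)" for i
  have N: "N i \<in> sets borel" "emeasure lborel (N i) = 0" for i
    using SN(4)[of i] by auto
  have "Z i \<in> null_sets lborel" for i
  proof -
    have "Z i \<in> sets borel"
      unfolding Z_def using N by (intro prod_set_borel) auto
    moreover have "emeasure lborel (Z i) = 0"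
      unfolding Z_def using N by (subst emeasure_lborel_prod_set) (auto intro!: bexI[of _ i])
    ultimately show ?thesis by auto
  qed
  then have Z: "(\<Union>i. Z i) \<in> null_sets lborel" by auto
  have sub: "prod_set S \<subseteq> prod_set B" using SN(1) by (auto simp: prod_set_def)
  have "prod_set B - prod_set S \<subseteq> (\<Union>i. Z i)"
  proof
    fix x assume x: "x \<in> prod_set B - prod_set S"
    then obtain i where "x $ i \<notin> S i" by (auto simp: prod_set_def)
    with x SN(2)[of i] have "x \<in> Z i" by (auto simp: prod_set_def Z_def)
    then show "x \<in> (\<Union>i. Z i)" by blast
  qed
  with Z have null: "prod_set B - prod_set S \<in> null_sets lebesgue"
    by (metis null_sets_completion_subset null_sets_completionI)
  have S: "prod_set S \<in> sets lebesgue" using prod_set_borel[of S, OF SN(3)] by auto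
  have eq: "prod_set B = prod_set S \<union> (prod_set B - prod_set S)" using sub by blast
  show meas: "prod_set B \<in> sets lebesgue"
    by (subst eq) (intro sets.Un S null_setsD2[OF null])
  have "emeasure lebesgue (B i) = emeasure lborel (S i)" for i
  proof -
    have "emeasure lebesgue (B i) \<le> emeasure lebesgue (S i \<union> N i)"
      using SN N by (intro emeasure_mono) auto
    also have "\<dots> = emeasure lborel (S i)"
      using SN N by (simp add: emeasure_Un_null_set)
    finally have "emeasure lebesgue (B i) \<le> emeasure lborel (S i)" .
    moreover have "emeasure lebesgue (S i) \<le> emeasure lebesgue (B i)"
      using SN assms by (intro emeasure_mono) auto
    ultimately show ?thesis using SN(3)[of i] by simp
  qed
  moreover have "emeasure lebesgue (prod_set B) = emeasure lebesgue (prod_set S)"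
    using S null by (subst eq) (rule emeasure_Un_null_set)
  ultimately show "emeasure lebesgue (prod_set B) = (\<Prod>i\<in>UNIV. emeasure lebesgue (B i))"
    using emeasure_lborel_prod_set[OF SN(3)] prod_set_borel[of S, OF SN(3)] by simp
qed

text \<open>
  Some piece of \<open>S\<close> cut out by a grid of mesh \<open>\<delta>\<close> is not null, so no intermediate value property
  of Lebesgue measure is needed.
\<close>

lemma lebesgue_small_subset:
  fixes S :: "real set"
  assumes "S \<in> sets lebesgue" "emeasure lebesgue S > 0" "\<delta> > 0"
  obtains E m where "E \<in> sets lebesgue" "E \<subseteq> S" "0 < m" "m \<le> \<delta>" "emeasure lebesgue E = ennreal m"
proof -
  \<comment> \<open>Neighbouring cells share an endpoint, which is harmless: what matters is that
    countably many cells of length \<delta> cover the line.\<close>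
  define I where "I n = {of_int n * \<delta> .. (of_int n + 1) * \<delta>}" for n :: int
  have "\<exists>n. emeasure lebesgue (S \<inter> I n) \<noteq> 0"
  proof (rule ccontr)
    assume "\<nexists>n. emeasure lebesgue (S \<inter> I n) \<noteq> 0"
    then have "(\<Union>n. S \<inter> I n) \<in> null_sets lebesgue"
      using assms(1) by (intro null_sets_UN) (auto simp: null_sets_def I_def)
    moreover have "(\<Union>n. S \<inter> I n) = S"
    proof -
      have "x \<in> I \<lfloor>x / \<delta>\<rfloor>" for x
        using assms(3) floor_divide_lower[OF assms(3), of x] floor_divide_upper[OF assms(3), of x]
        unfolding I_def by simp
      then show ?thesis by auto
    qed
    ultimately show False using assms(2) by auto
  qed
  then obtain n where n: "emeasure lebesgue (S \<inter> I n) \<noteq> 0" by blast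
  have "emeasure lebesgue (S \<inter> I n) \<le> emeasure lebesgue (I n)"
    by (intro emeasure_mono) (auto simp: I_def)
  also have "\<dots> = ennreal \<delta>"
    using assms(3) unfolding I_def by (simp add: algebra_simps)
  finally have le: "emeasure lebesgue (S \<inter> I n) \<le> ennreal \<delta>" .
  then obtain m where m: "m \<ge> 0" "emeasure lebesgue (S \<inter> I n) = ennreal m"
    by (metis ennreal_cases infinity_ennreal_def ennreal_less_top not_le top_unique)
  show ?thesis
  proof (rule that[of "S \<inter> I n" m])
    show "S \<inter> I n \<in> sets lebesgue" using assms(1) by (auto simp: I_def)
    show "0 < m" using m n by (auto simp: less_le)
    show "m \<le> \<delta>" using le m assms(3) by (simp add: ennreal_le_iff)
  qed (use m in auto)
qed

section \<open>Lorentz quasi-norms of indicators\<close>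

text \<open>Lets the mixed quasi-norm of a rectangle, the same at all levels below 1, be pulled out
  of the Lorentz integral.\<close>

lemma dilation_qnorm_cmult:
  assumes "0 < q" "h \<in> borel_measurable borel"
  shows "dilation_qnorm q (\<lambda>u. c * h u) = c * dilation_qnorm q h"
proof (cases "q = \<infinity>")
  case True
  then show ?thesis by (simp add: dilation_qnorm_def SUP_mult_left_ennreal)
next
  case False
  let ?a = "enn2real q"
  have a: "?a > 0" using assms(1) False by (rule enn2real_pos)
  have [measurable]: "h \<in> borel_measurable lborel" using assms(2) by simp
  have [measurable]: "(\<lambda>x. enn_powr (h x) ?a) \<in> borel_measurable lborel"
    unfolding enn_powr_def by measurable
  have "(\<integral>\<^sup>+t\<in>{0<..}. (enn_powr (c * h t) ?a / ennreal t) \<partial>lborel) =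
        (\<integral>\<^sup>+t. enn_powr c ?a * (enn_powr (h t) ?a / ennreal t * indicator {0<..} t) \<partial>lborel)"
    by (intro nn_integral_cong) (simp add: enn_powr_mult ennreal_times_divide flip: mult.assoc)
  also have "\<dots> = enn_powr c ?a * (\<integral>\<^sup>+t\<in>{0<..}. (enn_powr (h t) ?a / ennreal t) \<partial>lborel)"
    by (rule nn_integral_cmult) measurable
  finally show ?thesis
    using False a by (simp add: dilation_qnorm_def enn_powr_mult enn_powr_inverse)
qed

lemma dilation_qnorm_cong:
  assumes "\<And>t. t > 0 \<Longrightarrow> h t = h' t"
  shows "dilation_qnorm q h = dilation_qnorm q h'"
proof -
  have "(\<integral>\<^sup>+ t\<in>{0<..}. (enn_powr (h t) a / ennreal t) \<partial>lborel) =
        (\<integral>\<^sup>+ t\<in>{0<..}. (enn_powr (h' t) a / ennreal t) \<partial>lborel)" for a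
    using assms by (intro nn_integral_cong) (auto split: split_indicator)
  moreover have "(SUP t\<in>{0<..}. h t) = (SUP t\<in>{0<..}. h' t)"
    using assms by (intro SUP_cong) auto
  ultimately show ?thesis by (simp add: dilation_qnorm_def)
qed

text \<open>This is the profile in the level \<open>u\<close> that every characteristic function
  leaves behind. For finite \<open>q\<close> the integral is that of \<open>t powr (q - 1)\<close>
  over the unit interval, and the exponent exceeds -1.\<close>

lemma dilation_qnorm_truncated_id_finite:
  assumes "0 < q"
  shows "dilation_qnorm q (\<lambda>u. ennreal u * indicator {..<1} u) < top"
proof (cases "q = \<infinity>")
  case True
  have "(SUP t\<in>{0<..}. ennreal t * indicator {..<1} t) \<le> 1"
    by (intro SUP_least) (auto split: split_indicator)
  then show ?thesis using True by (auto simp: dilation_qnorm_def intro: le_less_trans)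
next
  case False
  let ?a = "enn2real q"
  have a: "?a > 0" using assms(1) False by (rule enn2real_pos)
  have "(\<integral>\<^sup>+t\<in>{0<..}. (enn_powr (ennreal t * indicator {..<1} t) ?a / ennreal t) \<partial>lborel) \<le>
        (\<integral>\<^sup>+t. indicator {0..1} t * ennreal (t powr (?a - 1)) \<partial>lborel)"
  proof (intro nn_integral_mono)
    fix t :: real
    have "enn_powr (ennreal t) ?a / ennreal t = ennreal (t powr (?a - 1))" if "0 < t"
      using that by (simp add: enn_powr_ennreal divide_ennreal powr_diff)
    then show "enn_powr (ennreal t * indicator {..<1} t) ?a / ennreal t * indicator {0<..} t
        \<le> indicator {0..1} t * ennreal (t powr (?a - 1))"
      by (auto split: split_indicator)
  qed
  also have "\<dots> = (\<integral>\<^sup>+t. ennreal (indicator {0..1} t * t powr (?a - 1)) \<partial>lborel)"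
    by (intro nn_integral_cong) (auto split: split_indicator)
  also have "\<dots> = ennreal (1 powr (?a - 1 + 1) / (?a - 1 + 1))"
    using a by (intro nn_integral_has_integral_lebesgue has_integral_powr_from_0) auto
  finally have "(\<integral>\<^sup>+t\<in>{0<..}. (enn_powr (ennreal t * indicator {..<1} t) ?a / ennreal t) \<partial>lborel) < top"
    by (rule le_less_trans) simp
  then show ?thesis using False by (simp add: dilation_qnorm_def flip: less_top)
qed

text \<open>The measure dt/t is invariant under dilation, so the interval from \<open>m / 2\<close>
  to \<open>m\<close> has a mass independent of \<open>m\<close>. This is what allows one \<kappa>
  for all \<open>m\<close>.\<close>

lemma dilation_qnorm_lower_bound:
  assumes "0 < s"
  obtains \<kappa> :: real where "\<kappa> > 0"
    "\<And>h a m. 0 < m \<Longrightarrow> (\<And>t. m / 2 \<le> t \<Longrightarrow> t < m \<Longrightarrow> a \<le> h t) \<Longrightarrow>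
       a * ennreal \<kappa> \<le> dilation_qnorm s h"
proof (cases "s = \<infinity>")
  case True
  \<comment> \<open>The supremum is at least the value at \<open>m / 2\<close>.\<close>
  have "a * ennreal 1 \<le> dilation_qnorm s h"
    if "0 < m" "\<And>t. m / 2 \<le> t \<Longrightarrow> t < m \<Longrightarrow> a \<le> h t" for h a and m :: real
    using that True by (auto simp: dilation_qnorm_def intro!: SUP_upper2[of "m / 2"])
  then show ?thesis using that[of 1] by simp
next
  case False
  let ?a = "enn2real s"
  have a: "?a > 0" using assms(1) False by (rule enn2real_pos)
  have "a * ennreal ((1 / 2) powr (1 / ?a)) \<le> dilation_qnorm s h"
    if m: "0 < m" and h: "\<And>t. m / 2 \<le> t \<Longrightarrow> t < m \<Longrightarrow> a \<le> h t" for h a and m :: real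
  proof -
    \<comment> \<open>Bounding 1/t below by 1/m on an interval of length m/2 gives mass 1/2 in place
      of the exact log 2.\<close>
    have "enn_powr a ?a * ennreal (1 / 2) = enn_powr a ?a * (ennreal (1 / m) * ennreal (m / 2))"
      using m by (simp flip: ennreal_mult)
    also have "\<dots> = (\<integral>\<^sup>+t. (enn_powr a ?a * ennreal (1 / m)) * indicator {m/2..<m} t \<partial>lborel)"
      using m by (subst nn_integral_cmult_indicator) (auto simp: mult.assoc)
    also have "\<dots> \<le> (\<integral>\<^sup>+t\<in>{0<..}. (enn_powr (h t) ?a / ennreal t) \<partial>lborel)"
    proof (intro nn_integral_mono)
      fix t :: real
      have "enn_powr a ?a * ennreal (1 / m) \<le> enn_powr (h t) ?a / ennreal t"
        if "m / 2 \<le> t" "t < m"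
      proof -
        have "ennreal (1 / m) \<le> inverse (ennreal t)"
          using that m by (subst inverse_ennreal) (auto simp: field_simps intro!: ennreal_leI)
        then show ?thesis
          using h[OF that] a unfolding divide_ennreal_def
          by (intro mult_mono enn_powr_mono) auto
      qed
      then show "enn_powr a ?a * ennreal (1 / m) * indicator {m/2..<m} t
          \<le> enn_powr (h t) ?a / ennreal t * indicator {0<..} t"
        using m by (auto split: split_indicator)
    qed
    finally have "enn_powr (enn_powr a ?a * ennreal (1 / 2)) (1 / ?a) \<le> dilation_qnorm s h"
      using False a by (simp add: dilation_qnorm_def enn_powr_mono)
    then show ?thesis
      using a by (simp add: enn_powr_mult enn_powr_inverse enn_powr_ennreal del: ennreal_half)
  qed
  then show ?thesis by (intro that[of "(1 / 2) powr (1 / ?a)"]) auto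
qed

text \<open>A positive level below 1 has all of \<open>A\<close> as its superlevel set, which is too
  large to be admissible at \<open>t\<close>.\<close>

lemma rearrangement_indicator_ge_1:
  assumes "A \<subseteq> space M" "ennreal t < emeasure M A"
  shows "1 \<le> rearrangement M (indicator A) t"
  unfolding rearrangement_def
proof (intro INF_greatest)
  fix \<sigma> :: real
  assume \<sigma>: "\<sigma> \<in> {\<sigma>. 0 < \<sigma> \<and> emeasure M {x \<in> space M. \<sigma> < \<bar>indicator A x :: real\<bar>} \<le> ennreal t}"
  have "\<sigma> \<ge> 1"
  proof (rule ccontr)
    assume "\<not> \<sigma> \<ge> 1"
    then have "{x \<in> space M. \<sigma> < \<bar>indicator A x :: real\<bar>} = A"
      using assms(1) \<sigma> by (auto split: split_indicator_asm)
    with \<sigma> assms(2) show False by auto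
  qed
  then show "1 \<le> ennreal \<sigma>" by simp
qed

text \<open>For \<open>t\<close> from \<open>m / 2\<close> up to \<open>m\<close> the rearrangement
  is at least 1 and the weight at least \<open>(m / 2) powr (1 / r)\<close>. The constant is chosen
  before \<open>M\<close>, \<open>A\<close> and \<open>m\<close>, so it serves arbitrarily thin
  rectangles.\<close>

lemma lorentz_qnorm_indicator_lower_bound:
  assumes "0 < s" "0 < r"
  obtains \<kappa> :: real where "\<kappa> > 0"
    "\<And>(M :: 'a measure) A m. 0 < m \<Longrightarrow> A \<subseteq> space M \<Longrightarrow> emeasure M A = ennreal m \<Longrightarrow>
       ennreal (\<kappa> * m powr (1 / r)) \<le> lorentz_qnorm M r s (indicator A)"
proof -
  obtain \<kappa> where \<kappa>: "\<kappa> > 0"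
    "\<And>h a m. 0 < m \<Longrightarrow> (\<And>t. m / 2 \<le> t \<Longrightarrow> t < m \<Longrightarrow> a \<le> h t) \<Longrightarrow>
       a * ennreal \<kappa> \<le> dilation_qnorm s h"
    using dilation_qnorm_lower_bound[OF assms(1)] by blast
  have "ennreal (\<kappa> * (1 / 2) powr (1 / r) * m powr (1 / r)) \<le> lorentz_qnorm M r s (indicator A)"
    if m: "0 < m" "A \<subseteq> space M" "emeasure M A = ennreal m" for M :: "'a measure" and A m
  proof -
    have "ennreal ((m / 2) powr (1 / r)) \<le>
        ennreal (t powr (1 / r)) * rearrangement M (indicator A) t" if "m / 2 \<le> t" "t < m" for t
    proof -
      have "ennreal ((m / 2) powr (1 / r)) * 1 \<le>
        ennreal (t powr (1 / r)) * rearrangement M (indicator A) t"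
        using that m assms(2)
        by (intro mult_mono rearrangement_indicator_ge_1) (auto simp: powr_mono2 ennreal_less_iff)
      then show ?thesis by simp
    qed
    then have "ennreal ((m / 2) powr (1 / r)) * ennreal \<kappa> \<le> lorentz_qnorm M r s (indicator A)"
      unfolding lorentz_qnorm_def using m(1) by (intro \<kappa>(2)[of m])
    moreover have "(m / 2) powr (1 / r) * \<kappa> = \<kappa> * (1 / 2) powr (1 / r) * m powr (1 / r)"
      using m(1) powr_mult[of m "1 / 2" "1 / r"] by simp
    ultimately show ?thesis
      using \<kappa>(1) by (simp flip: ennreal_mult)
  qed
  then show ?thesis using \<kappa>(1) by (intro that[of "\<kappa> * (1 / 2) powr (1 / r)"]) auto
qed

section \<open>Mixed quasi-norms of sub-rectangles\<close>

text \<open>Sides with infinite exponent are kept full, so that the essential supremum there is that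
  of a constant; all other sides may shrink.\<close>

locale subrectangle =
  fixes \<Omega> B :: "'n::{finite,linorder} \<Rightarrow> real set" and p :: "'n \<Rightarrow> ennreal"
  assumes p_pos: "\<And>i. 0 < p i"
    and \<Omega>_sets: "\<And>i. \<Omega> i \<in> sets lebesgue"
    and \<Omega>_pos: "\<And>i. emeasure lebesgue (\<Omega> i) > 0"
    and B_sets: "\<And>i. B i \<in> sets lebesgue"
    and B_sub: "\<And>i. B i \<subseteq> \<Omega> i"
    and B_full: "\<And>i. p i = \<infinity> \<Longrightarrow> B i = \<Omega> i"
begin

lemma prod_set_sub: "prod_set B \<subseteq> prod_set \<Omega>"
  using B_sub by (auto simp: prod_set_def)

lemma indicator_measurable: "indicator (prod_set B) \<in> borel_measurable (lebesgue_on (prod_set \<Omega>))"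
  using prod_set_sub prod_set_lebesgue[of B, OF B_sets] prod_set_lebesgue[of \<Omega>, OF \<Omega>_sets]
  by (intro borel_measurable_indicator) (auto simp: sets_restrict_space_iff)

lemma emeasure_prod_set:
  "emeasure (lebesgue_on (prod_set \<Omega>)) (prod_set B) = (\<Prod>i\<in>UNIV. emeasure lebesgue (B i))"
  using prod_set_sub prod_set_lebesgue[of \<Omega>, OF \<Omega>_sets] emeasure_lebesgue_prod_set(2)[of B, OF B_sets]
  by (simp add: emeasure_restrict_space)

text \<open>The scalar \<open>c\<close> is kept so that the value 1 gives the rectangle and the
  value 0 the empty set.\<close>

lemma iter_qnorm_indicator:
  "iter_qnorm \<Omega> p (sorted_list_of_set UNIV) (\<lambda>x. c * indicator (prod_set B) x) 0 =
   c * (\<Prod>j\<in>UNIV. Lp_qnorm (p j) (lebesgue_on (\<Omega> j)) (indicator (B j)))"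
proof -
  have "B i \<in> sets (lebesgue_on (\<Omega> i)) \<and> emeasure (lebesgue_on (\<Omega> i)) (\<Omega> i) \<noteq> 0" for i
    using B_sets[of i] \<Omega>_sets[of i] B_sub[of i] \<Omega>_pos[of i]
    by (auto simp: sets_restrict_space_iff emeasure_restrict_space)
  then show ?thesis
    using iter_qnorm_prod_indicator[of "sorted_list_of_set UNIV" p B \<Omega> c 0] p_pos B_full
    by (simp add: indicator_prod_set)
qed

lemma mixed_qnorm_indicator:
  "mixed_qnorm \<Omega> p (indicator (prod_set B)) =
   (\<Prod>j\<in>UNIV. Lp_qnorm (p j) (lebesgue_on (\<Omega> j)) (indicator (B j)))"
proof -
  have "(\<lambda>x. ennreal \<bar>indicator (prod_set B) x\<bar>) = (\<lambda>x. 1 * indicator (prod_set B) x)"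
    by (auto simp: fun_eq_iff split: split_indicator)
  then show ?thesis unfolding mixed_qnorm_def using iter_qnorm_indicator[of 1] by simp
qed

lemma mixed_qnorm_indicator_empty: "mixed_qnorm \<Omega> p (indicator {}) = 0"
proof -
  have "(\<lambda>x. ennreal \<bar>indicator {} x\<bar>) = (\<lambda>x. 0 * indicator (prod_set B) x)"
    by (auto simp: fun_eq_iff)
  then show ?thesis unfolding mixed_qnorm_def using iter_qnorm_indicator[of 0] by simp
qed

text \<open>The superlevel set of the characteristic function is the rectangle for positive levels
  below 1 and empty from level 1 on, so the integrand factorizes.\<close>

lemma mixed_lorentz_qnorm_indicator:
  assumes "0 < q"
  shows "mixed_lorentz_qnorm \<Omega> p q (indicator (prod_set B)) =
    mixed_qnorm \<Omega> p (indicator (prod_set B)) *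
    dilation_qnorm q (\<lambda>u. ennreal u * indicator {..<1} u)"
proof -
  let ?A = "\<lambda>u. {x \<in> prod_set \<Omega>. \<bar>indicator (prod_set B) x :: real\<bar> > u}"
  have "ennreal u * mixed_qnorm \<Omega> p (indicator (?A u)) =
      mixed_qnorm \<Omega> p (indicator (prod_set B)) * (ennreal u * indicator {..<1} u)" if "u > 0" for u
  proof (cases "u < 1")
    case True
    then have "?A u = prod_set B"
      using that prod_set_sub by (auto split: split_indicator_asm)
    with True show ?thesis by (simp add: mult.commute)
  next
    case False
    then have "?A u = {}" by (auto split: split_indicator)
    with False show ?thesis by (simp only: mixed_qnorm_indicator_empty) simp
  qed
  then show ?thesis
    unfolding mixed_lorentz_qnorm_def using assms
    by (subst dilation_qnorm_cmult[symmetric]) (auto intro!: dilation_qnorm_cong)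
qed

end

section \<open>Competing powers of a small parameter exclude an embedding\<close>

text \<open>Dividing the embedding inequality by \<open>m powr (1 / r)\<close> bounds \<kappa> by a
  constant times \<open>m powr (1 / a - 1 / r)\<close>, which tends to 0 with \<open>m\<close>. The
  quasi-norms stay abstract so that both claims of the theorem can use this.\<close>

lemma not_cont_embedded_fun_space:
  assumes "0 < a" "a < r" "0 < \<kappa>" "0 \<le> C"
    and small: "\<And>\<delta>. \<delta> > 0 \<Longrightarrow> \<exists>f m. 0 < m \<and> m \<le> \<delta> \<and> f \<in> borel_measurable M \<and>
           N\<^sub>1 f \<le> ennreal (C * m powr (1 / a)) \<and> ennreal (\<kappa> * m powr (1 / r)) \<le> N\<^sub>2 f"
  shows "\<not> fun_space M N\<^sub>1 \<hookrightarrow> fun_space M N\<^sub>2"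
proof
  assume "fun_space M N\<^sub>1 \<hookrightarrow> fun_space M N\<^sub>2"
  then obtain c :: real where c: "c > 0"
      "\<And>f. f \<in> borel_measurable M \<Longrightarrow> N\<^sub>1 f < \<infinity> \<Longrightarrow> N\<^sub>2 f \<le> ennreal c * N\<^sub>1 f"
    by (auto simp: cont_embedded_def fun_space_def)
  define e where "e = 1 / a - 1 / r"
  have e: "e > 0" using assms(1,2) by (simp add: e_def field_simps)
  \<comment> \<open>\<open>m powr e\<close> falls below \<open>y\<close> once \<open>m\<close> is at
    most \<open>y powr (1 / e)\<close>. Adding 1 keeps the denominator positive when
    \<open>C\<close> is 0 and makes the final inequality strict.\<close>
  define y where "y = \<kappa> / (c * C + 1)"
  have D: "c * C + 1 > 0" using c(1) assms(4) by (simp add: add_nonneg_pos)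
  have y: "y > 0" using D assms(3) by (simp add: y_def)
  obtain f m where m: "0 < m" "m \<le> y powr (1 / e)" and f: "f \<in> borel_measurable M"
      "N\<^sub>1 f \<le> ennreal (C * m powr (1 / a))" "ennreal (\<kappa> * m powr (1 / r)) \<le> N\<^sub>2 f"
    using small[of "y powr (1 / e)"] y by auto
  have "N\<^sub>1 f < \<infinity>" using f(2) by (auto intro: le_less_trans)
  then have "ennreal (\<kappa> * m powr (1 / r)) \<le> ennreal c * ennreal (C * m powr (1 / a))"
    using c(2)[OF f(1)] f(2,3) by (meson order_trans mult_left_mono zero_le)
  then have "\<kappa> * m powr (1 / r) \<le> c * (C * m powr (1 / a))"
    using c(1) assms(4) by (simp add: ennreal_le_iff flip: ennreal_mult)
  moreover have "m powr (1 / a) = m powr e * m powr (1 / r)"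
    by (simp add: e_def flip: powr_add)
  ultimately have "\<kappa> * m powr (1 / r) \<le> (c * C * m powr e) * m powr (1 / r)"
    by (simp add: mult.assoc)
  then have "\<kappa> \<le> c * C * m powr e"
    using m(1) by (simp add: mult_le_cancel_right)
  also have "m powr e \<le> y"
    using powr_mono2[of e m "y powr (1 / e)"] m e y by (simp add: powr_powr)
  then have "c * C * m powr e \<le> c * C * y"
    using c(1) assms(4) by (intro mult_left_mono) auto
  also have "c * C * y < (c * C + 1) * y" using y by (simp add: algebra_simps)
  also have "\<dots> = \<kappa>" using D by (simp add: y_def)
  finally show False by simp
qed

section \<open>Thin rectangles tested against both embeddings\<close>

theorem corollary7p5:
  fixes \<Omega> :: "'n::{finite,linorder} \<Rightarrow> real set"
    and p :: "'n \<Rightarrow> ennreal"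
    and r :: real
  assumes "\<And>i. \<Omega> i \<in> sets lebesgue"
    and "\<And>i. emeasure lebesgue (\<Omega> i) > 0"
    and "emeasure lebesgue (prod_set \<Omega>) < \<infinity>"
    and "\<And>i. 0 < p i"
    and "0 < Min (range p)" and "Min (range p) < \<infinity>"
    and "ennreal r > Min (range p)"
  shows "\<not> (mixed_Lebesgue_space \<Omega> p \<hookrightarrow> Lebesgue_space \<Omega> (ennreal r)) \<and>
         (\<forall>q s :: ennreal. 0 < q \<longrightarrow> 0 < s \<longrightarrow>
            \<not> (mixed_Lorentz_space \<Omega> p q \<hookrightarrow> Lorentz_space \<Omega> r s))"
proof -
  have "Min (range p) \<in> range p" by (intro Min_in) auto
  \<comment> \<open>The direction to shrink attains the smallest exponent; that exponent is finite
    and positive, hence a real number \<open>a\<close>.\<close>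
  then obtain k where k: "p k = Min (range p)" by (metis rangeE)
  define a where "a = enn2real (p k)"
  have pk: "p k = ennreal a" "p k \<noteq> \<infinity>" using assms(6) by (auto simp: a_def k)
  have a: "a > 0" using assms(4)[of k] pk by (simp add: ennreal_less_zero_iff)
  have ar: "a < r" using assms(7) a pk k by (simp add: ennreal_less_iff)
  have r: "r > 0" using a ar by simp
  let ?M = "lebesgue_on (prod_set \<Omega>)"
  let ?rest = "UNIV - {k}"

  \<comment> \<open>All sides have positive measure, so no zero factor can mask an infinite one, and
    finiteness passes from the product to each side.\<close>
  have "(\<Prod>i\<in>UNIV. emeasure lebesgue (\<Omega> i)) \<noteq> top"
    using assms(3) emeasure_lebesgue_prod_set(2)[of \<Omega>, OF assms(1)] by auto
  then have fin: "emeasure lebesgue (\<Omega> i) \<noteq> top" for i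
    using assms(2) by (auto simp: ennreal_prod_eq_top) (metis less_irrefl)
  define w where "w i = measure lebesgue (\<Omega> i)" for i
  have w: "emeasure lebesgue (\<Omega> i) = ennreal (w i)" for i
    unfolding w_def using fin by (rule emeasure_eq_ennreal_measure)
  have w_pos: "w i > 0" for i
    using assms(2)[of i] by (simp add: w)
  \<comment> \<open>The contribution of the untouched sides to the measure; it stays fixed while
    \<open>m\<close> shrinks.\<close>
  define W where "W = (\<Prod>i\<in>?rest. w i)"
  have W: "W > 0" unfolding W_def using w_pos by (intro prod_pos) auto

  \<comment> \<open>Contribution of a full side to the mixed quasi-norm: 1 for an infinite exponent,
    otherwise a power of a finite measure. Those with index other than \<open>k\<close> multiply to
    the constant \<open>C\<close>.\<close>
  define L where "L i = Lp_qnorm (p i) (lebesgue_on (\<Omega> i)) (indicator (\<Omega> i))" for i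
  have "L i \<noteq> top" for i
  proof (cases "p i = \<infinity>")
    case True
    then show ?thesis
      using Lp_qnorm_indicator_infinity[of "lebesgue_on (\<Omega> i)" "\<Omega> i" 1] assms(1,2)[of i]
      by (simp add: L_def emeasure_restrict_space)
  next
    case False
    then show ?thesis
      using assms(1)[of i] fin[of i] by (simp add: L_def Lp_qnorm_indicator emeasure_restrict_space)
  qed
  then have "(\<Prod>i\<in>?rest. L i) \<noteq> top" by (auto simp: ennreal_prod_eq_top)
  then obtain C where C: "C \<ge> 0" "(\<Prod>i\<in>?rest. L i) = ennreal C"
    by (cases "\<Prod>i\<in>?rest. L i" rule: ennreal_cases) auto

  \<comment> \<open>One family of rectangles serves both claims. Here \<open>m\<close> measures the
    shrunken side, while the rectangle itself has measure \<open>m * W\<close>.\<close>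
  have witness: "\<exists>A m. 0 < m \<and> m \<le> \<delta> \<and> A \<subseteq> prod_set \<Omega> \<and> (indicator A :: _ \<Rightarrow> real) \<in> borel_measurable ?M \<and>
      A \<in> sets ?M \<and> emeasure ?M A = ennreal (m * W) \<and>
      mixed_qnorm \<Omega> p (indicator A) = ennreal (C * m powr (1 / a)) \<and>
      (\<forall>q. 0 < q \<longrightarrow> mixed_lorentz_qnorm \<Omega> p q (indicator A) =
        ennreal (C * m powr (1 / a)) * dilation_qnorm q (\<lambda>u. ennreal u * indicator {..<1} u))"
    if \<delta>: "\<delta> > 0" for \<delta>
  proof -
    obtain E m where E: "E \<in> sets lebesgue" "E \<subseteq> \<Omega> k" "0 < m" "m \<le> \<delta>"
        "emeasure lebesgue E = ennreal m"
      by (rule lebesgue_small_subset[OF assms(1)[of k] assms(2)[of k] \<delta>])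
    define B where "B = fun_upd \<Omega> k E"
    \<comment> \<open>The only side that shrinks has the finite exponent \<open>p k\<close>, so
      sides with infinite exponent stay full.\<close>
    interpret subrectangle \<Omega> B p
      using assms(1,2,4) E pk by unfold_locales (auto simp: B_def)
    have Bk: "B k = E" by (simp add: B_def)
    have split: "prod g UNIV = g k * prod g ?rest" for g :: "'n \<Rightarrow> ennreal"
      by (rule prod.remove) auto
    have "emeasure ?M (prod_set B) = ennreal (m * W)"
    proof -
      have "(\<Prod>i\<in>?rest. emeasure lebesgue (B i)) = (\<Prod>i\<in>?rest. ennreal (w i))"
        by (intro prod.cong) (auto simp: B_def w)
      also have "\<dots> = ennreal W"
        unfolding W_def using w_pos by (intro prod_ennreal) (auto intro: less_imp_le)
      finally show ?thesis
        using E(3,5) W Bk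
        by (simp add: emeasure_prod_set split ennreal_mult del: emeasure_completion)
    qed
    moreover have "mixed_qnorm \<Omega> p (indicator (prod_set B)) = ennreal (C * m powr (1 / a))"
    proof -
      have "(\<Prod>i\<in>?rest. Lp_qnorm (p i) (lebesgue_on (\<Omega> i)) (indicator (B i))) = (\<Prod>i\<in>?rest. L i)"
        by (intro prod.cong) (auto simp: B_def L_def)
      moreover have "Lp_qnorm (p k) (lebesgue_on (\<Omega> k)) (indicator (B k)) = ennreal (m powr (1 / a))"
        using E assms(1)[of k] pk(2)
        by (simp add: Lp_qnorm_indicator Bk sets_restrict_space_iff emeasure_restrict_space
            enn_powr_ennreal del: emeasure_completion flip: a_def)
      ultimately show ?thesis
        using C by (simp add: mixed_qnorm_indicator split ennreal_mult mult.commute)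
    qed
    moreover have "prod_set B \<in> sets ?M"
      using prod_set_sub prod_set_lebesgue[of B, OF B_sets] prod_set_lebesgue[of \<Omega>, OF assms(1)]
      by (auto simp: sets_restrict_space_iff)
    ultimately show ?thesis
      using E(3,4) prod_set_sub indicator_measurable mixed_lorentz_qnorm_indicator
      by (intro exI[of _ "prod_set B"] exI[of _ m]) simp
  qed

  have "\<not> (mixed_Lebesgue_space \<Omega> p \<hookrightarrow> Lebesgue_space \<Omega> (ennreal r))"
    unfolding mixed_Lebesgue_space_def Lebesgue_space_def
  proof (rule not_cont_embedded_fun_space[OF a ar])
    \<comment> \<open>The lower constant is exact: the Lebesgue quasi-norm of the rectangle is the
      1/r-th power of \<open>m * W\<close>.\<close>
    show "0 < W powr (1 / r)" using W by simp
    fix \<delta> :: real assume "\<delta> > 0"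
    then obtain A m where A: "0 < m" "m \<le> \<delta>" "(indicator A :: _ \<Rightarrow> real) \<in> borel_measurable ?M" "A \<in> sets ?M"
        "emeasure ?M A = ennreal (m * W)"
        "mixed_qnorm \<Omega> p (indicator A) = ennreal (C * m powr (1 / a))"
      using witness[OF \<open>\<delta> > 0\<close>] by blast
    have "(\<lambda>x. ennreal \<bar>indicator A x\<bar>) = indicator A"
      by (auto simp: fun_eq_iff split: split_indicator)
    then have "Lp_qnorm (ennreal r) ?M (\<lambda>x. ennreal \<bar>indicator A x\<bar>) =
        ennreal (W powr (1 / r) * m powr (1 / r))"
      using A r W by (simp add: Lp_qnorm_indicator enn_powr_ennreal powr_mult mult.commute)
    with A show "\<exists>f m. 0 < m \<and> m \<le> \<delta> \<and> f \<in> borel_measurable ?M \<and>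
        mixed_qnorm \<Omega> p f \<le> ennreal (C * m powr (1 / a)) \<and>
        ennreal (W powr (1 / r) * m powr (1 / r)) \<le> Lp_qnorm (ennreal r) ?M (\<lambda>x. ennreal \<bar>f x\<bar>)"
      by (intro exI[of _ "indicator A"] exI[of _ m]) simp
  qed (rule C(1))
  moreover have "\<not> (mixed_Lorentz_space \<Omega> p q \<hookrightarrow> Lorentz_space \<Omega> r s)" if q: "0 < q" and s: "0 < s" for q s
  proof -
    \<comment> \<open>\<open>D\<close> depends on \<open>q\<close> alone and turns the upper
      constant \<open>C\<close> into \<open>C * D\<close>.\<close>
    obtain D where D: "D \<ge> 0" "dilation_qnorm q (\<lambda>u. ennreal u * indicator {..<1} u) = ennreal D"
      using dilation_qnorm_truncated_id_finite[OF q]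
      by (cases "dilation_qnorm q (\<lambda>u. ennreal u * indicator {..<1} u)" rule: ennreal_cases) auto
    \<comment> \<open>\<kappa> is fixed before \<delta>. It will be applied to the measure
      \<open>m * W\<close>, which adds the factor \<open>W powr (1 / r)\<close> to the lower
      constant.\<close>
    obtain \<kappa> where \<kappa>: "\<kappa> > 0"
      "\<And>(M :: (real, 'n) vec measure) A m. 0 < m \<Longrightarrow> A \<subseteq> space M \<Longrightarrow> emeasure M A = ennreal m \<Longrightarrow>
         ennreal (\<kappa> * m powr (1 / r)) \<le> lorentz_qnorm M r s (indicator A)"
      using lorentz_qnorm_indicator_lower_bound[OF s r] by blast
    show ?thesis
      unfolding mixed_Lorentz_space_def Lorentz_space_def
    proof (rule not_cont_embedded_fun_space[OF a ar])
      show "0 < \<kappa> * W powr (1 / r)" using W \<kappa>(1) by simp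
      show "0 \<le> C * D" using C(1) D(1) by simp
      fix \<delta> :: real assume "\<delta> > 0"
      then obtain A m where A: "0 < m" "m \<le> \<delta>" "(indicator A :: _ \<Rightarrow> real) \<in> borel_measurable ?M"
          "A \<subseteq> prod_set \<Omega>" "emeasure ?M A = ennreal (m * W)"
          "mixed_lorentz_qnorm \<Omega> p q (indicator A) = ennreal (C * m powr (1 / a)) *
            dilation_qnorm q (\<lambda>u. ennreal u * indicator {..<1} u)"
        using witness[OF \<open>\<delta> > 0\<close>] q by blast
      have "mixed_lorentz_qnorm \<Omega> p q (indicator A) = ennreal (C * D * m powr (1 / a))"
        using A(6) C(1) D by (simp add: mult_ac flip: ennreal_mult)
      moreover have "ennreal (\<kappa> * W powr (1 / r) * m powr (1 / r)) \<le> lorentz_qnorm ?M r s (indicator A)"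
        using \<kappa>(2)[of "m * W" A ?M] A W by (simp add: powr_mult mult_ac)
      ultimately show "\<exists>f m. 0 < m \<and> m \<le> \<delta> \<and> f \<in> borel_measurable ?M \<and>
          mixed_lorentz_qnorm \<Omega> p q f \<le> ennreal (C * D * m powr (1 / a)) \<and>
          ennreal (\<kappa> * W powr (1 / r) * m powr (1 / r)) \<le> lorentz_qnorm ?M r s f"
        using A(1-3) by (intro exI[of _ "indicator A"] exI[of _ m]) simp
    qed
  qed
  ultimately show ?thesis by blast
qed

end
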